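(* For every integer $d\ge 8$ and every integer $\alpha$ with $2\le\alpha\le d-2$, $h_\alpha([0,1]^d)>2^{d-\alpha}$.
   Context: Let $B\subset\mathbb{R}^d$ be a convex body (compact convex set with non-empty interior). A direction is given by a unit vector $l\in\mathbb{R}^d$. A boundary point $x$ of $B$ is illuminated by the direction $l$ if the ray $\{x+tl: t>0\}$ intersects the interior of $B$. For $\alpha>0$, $h_\alpha(B)$ is the minimal cardinality of a finite set $\mathcal{L}$ of directions such that the set of boundary points of $B$ not illuminated by any direction in $\mathcal{L}$ has Hausdorff dimension less than $\alpha$. *)

theory Defs
  imports "HOL-Analysis.Analysis"
begin

text \<open>
  The power \<open>diam(U)\<^sup>s\<close> with the usual conventions of geometric measure theory: the empty set
  contributes \<open>0\<close>, and for \<open>s = 0\<close> every nonempty set contributes \<open>1\<close>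
  (whereas \<open>0 powr 0 = 0\<close>).
\<close>
definition diam_pow :: "real \<Rightarrow> 'a::metric_space set \<Rightarrow> ennreal" where
  "diam_pow s U =
     (if U = {} then 0 else if s = 0 then 1 else ennreal (diameter U powr s))"

text \<open>Boundedness is required explicitly because \<open>diameter\<close> is meaningless on unbounded sets.\<close>
definition hausdorff_premeasure :: "real \<Rightarrow> real \<Rightarrow> 'a::metric_space set \<Rightarrow> ennreal" where
  "hausdorff_premeasure s \<delta> A =
     (INF U \<in> {U :: nat \<Rightarrow> 'a set.
                 A \<subseteq> (\<Union>i. U i) \<and> (\<forall>i. bounded (U i) \<and> diameter (U i) \<le> \<delta>)}.
        \<Sum>i. diam_pow s (U i))"

definition hausdorff_measure :: "real \<Rightarrow> 'a::metric_space set \<Rightarrow> ennreal" where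
  "hausdorff_measure s A = (SUP \<delta> \<in> {0<..}. hausdorff_premeasure s \<delta> A)"

definition hausdorff_dim :: "'a::metric_space set \<Rightarrow> ennreal" where
  "hausdorff_dim A = (INF s \<in> {s. 0 \<le> s \<and> hausdorff_measure s A = 0}. ennreal s)"

definition illuminates :: "'a::euclidean_space set \<Rightarrow> 'a \<Rightarrow> 'a \<Rightarrow> bool" where
  "illuminates B l x \<longleftrightarrow> {x + t *\<^sub>R l | t. t > 0} \<inter> interior B \<noteq> {}"

definition unilluminated :: "'a::euclidean_space set \<Rightarrow> 'a set \<Rightarrow> 'a set" where
  "unilluminated B L = {x \<in> frontier B. \<forall>l\<in>L. \<not> illuminates B l x}"

text \<open>
  For a convex body \<open>B\<close> and \<open>\<alpha> > 0\<close> the minimum is over a nonempty set of cardinalities, since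
  finitely many directions illuminate the whole boundary.
\<close>
definition illum_number :: "real \<Rightarrow> 'a::euclidean_space set \<Rightarrow> nat" where
  "illum_number \<alpha> B =
     (LEAST n. \<exists>L. finite L \<and> card L = n \<and> (\<forall>l\<in>L. norm l = 1) \<and>
                   hausdorff_dim (unilluminated B L) < ennreal \<alpha>)"

end

theory Submission
  imports Defs
begin

text \<open>
  A direction \<open>l\<close> illuminates a relatively interior point of a face of the cube only if, in every
  coordinate that is constant on the face, the sign of \<open>l\<close> points from that face into the cube.
  So \<open>l\<close> enters only through the Boolean word recording which of its coordinates are negative.
  If some \<open>\<alpha>\<close>-dimensional face had no illuminated relatively interior point, its
  relative interior would be unilluminated, and a volume comparison
  (\<open>card_le_hausdorff_dim\<close>) shows that its Hausdorff dimension is at least \<open>\<alpha>\<close>.  Hence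
  the words of an admissible set of directions show every pattern on every set of
  \<open>t = d - \<alpha>\<close> coordinates: they form a binary covering array of strength \<open>t\<close>.

  Such an array needs \<open>2\<^sup>t\<close> words.  With no more than that, each pattern on \<open>t\<close> coordinates
  occurs exactly once, so distinct words never agree on \<open>t\<close> coordinates (an MDS code).  For
  \<open>2 \<le> t \<le> d - 2\<close> this is impossible over a two-letter alphabet
  (\<open>covering_array_card_gt\<close>): two words obtained from a given one by changing two different
  information coordinates must both flip the same two check coordinates, and so are too close to
  each other.
\<close>

section \<open>Binary covering arrays\<close>

text \<open>
  Restriction to \<open>T\<close> maps \<open>C\<close> onto a set with at least as many elements as \<open>C\<close>, so it is
  injective.
\<close>
lemma covering_array_eqI:
  fixes C :: "('n::finite \<Rightarrow> bool) set"
  assumes cover: "\<And>v. \<exists>c\<in>C. \<forall>i\<in>T. c i = v i"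
    and card: "card C \<le> 2 ^ card T"
    and "c \<in> C" "c' \<in> C" and agree: "\<And>i. i \<in> T \<Longrightarrow> c i = c' i"
  shows "c = c'"
proof -
  let ?P = "T \<rightarrow>\<^sub>E (UNIV :: bool set)"
  have "?P \<subseteq> (\<lambda>c. restrict c T) ` C"
  proof
    fix v assume v: "v \<in> ?P"
    obtain c where c: "c \<in> C" "\<forall>i\<in>T. c i = v i" using cover by blast
    have "restrict c T = v"
      using c(2) v by (auto simp: fun_eq_iff PiE_def extensional_def restrict_def)
    then show "v \<in> (\<lambda>c. restrict c T) ` C" using c(1) by blast
  qed
  moreover have "(\<lambda>c. restrict c T) ` C \<subseteq> ?P" by auto
  ultimately have "(\<lambda>c. restrict c T) ` C = ?P" by blast
  moreover have "card ?P = 2 ^ card T" by (simp add: card_PiE)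
  ultimately have "card C \<le> card ((\<lambda>c. restrict c T) ` C)" using card by simp
  then have "inj_on (\<lambda>c. restrict c T) C"
    by (intro eq_card_imp_inj_on antisym card_image_le) auto
  moreover have "restrict c T = restrict c' T" using agree by (auto simp: restrict_def)
  ultimately show ?thesis using assms(3,4) by (auto dest: inj_onD)
qed

text \<open>
  The strength must be at least \<open>2\<close> to have two coordinates to change independently: for strength
  \<open>1\<close> the two constant words are a covering array of any length.  With a single further
  coordinate the words of even weight would be a covering array with \<open>2\<^sup>t\<close> members.
\<close>
lemma covering_array_card_gt:
  fixes C :: "('n::finite \<Rightarrow> bool) set"
  assumes t: "2 \<le> t" "t + 2 \<le> CARD('n)"
    and cover: "\<And>T v. card T = t \<Longrightarrow> \<exists>c\<in>C. \<forall>i\<in>T. c i = v i"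
  shows "2 ^ t < card C"
proof (rule ccontr)
  assume "\<not> 2 ^ t < card C"
  then have eqI: "c = c'"
    if "card T = t" "c \<in> C" "c' \<in> C" "\<And>i. i \<in> T \<Longrightarrow> c i = c' i" for T c c'
    using covering_array_eqI[of C T c c'] cover that by simp
  obtain S :: "'n set" where S: "card S = t + 2"
    using obtain_subset_with_card_n[OF t(2)] by blast
  have "2 \<le> card S" using S by simp
  then obtain p q where pq: "p \<in> S" "q \<in> S" "p \<noteq> q"
    by (meson card_2_iff' obtain_subset_with_card_n subsetD)
  define T where "T = S - {p, q}"
  have T: "card T = t" using S pq by (simp add: T_def card_Diff_subset)
  have pqT: "p \<notin> T" "q \<notin> T" by (auto simp: T_def)
  have "2 \<le> card T" using T t by simp
  then obtain a b where ab: "a \<in> T" "b \<in> T" "a \<noteq> b"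
    by (meson card_2_iff' obtain_subset_with_card_n subsetD)
  obtain c where c: "c \<in> C" using cover[OF T] by blast
  have flip: "\<exists>c'\<in>C. c' x \<noteq> c x \<and> c' p \<noteq> c p \<and> c' q \<noteq> c q \<and> (\<forall>i\<in>T - {x}. c' i = c i)"
    if x: "x \<in> T" for x
  proof -
    obtain c' where c': "c' \<in> C" "\<forall>i\<in>T. c' i = (c(x := \<not> c x)) i"
      using cover[OF T] by blast
    have "c' r \<noteq> c r" if r: "r \<notin> T" for r
    proof
      assume same: "c' r = c r"
      have "card (insert r (T - {x})) = t" using r x T t by simp
      then have "c' = c"
      proof (rule eqI)
        fix i assume "i \<in> insert r (T - {x})"
        then show "c' i = c i" using same c'(2) by (cases "i = r") auto
      qed (rule c'(1), rule c)
      then show False using c' x by auto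
    qed
    then show ?thesis using c' x pqT by (intro bexI[of _ c']) auto
  qed
  obtain c1 where c1: "c1 \<in> C" "c1 a \<noteq> c a" "c1 p \<noteq> c p" "c1 q \<noteq> c q"
    "\<forall>i\<in>T - {a}. c1 i = c i" using flip[OF ab(1)] by blast
  obtain c2 where c2: "c2 \<in> C" "c2 b \<noteq> c b" "c2 p \<noteq> c p" "c2 q \<noteq> c q"
    "\<forall>i\<in>T - {b}. c2 i = c i" using flip[OF ab(2)] by blast
  have "card (T - {a, b}) = t - 2" using T ab by (simp add: card_Diff_subset)
  then have "card (insert p (insert q (T - {a, b}))) = t" using pq pqT t by simp
  then have "c1 = c2"
  proof (rule eqI)
    fix i assume "i \<in> insert p (insert q (T - {a, b}))"
    then consider "i = p" | "i = q" | "i \<in> T - {a}" "i \<in> T - {b}" by blast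
    then show "c1 i = c2 i" using c1(3-5) c2(3-5) by cases auto
  qed (rule c1(1), rule c2(1))
  then show False using c1 c2 ab by auto
qed

section \<open>A lower bound for the Hausdorff dimension\<close>

text \<open>
  Instead of projecting to the coordinate subspace spanned by \<open>J\<close>, the piece \<open>U\<close> is thickened to
  full dimension by letting the remaining coordinates run through \<open>[0,1]\<close>.  These sides
  contribute the factor \<open>1\<close> to the volume, and \<open>U\<close> thickens into a box whose sides in the
  directions of \<open>J\<close> are \<open>2 * diameter U\<close>.  As the diameter is at most \<open>1\<close>, lowering the exponent
  from \<open>card J\<close> to \<open>s\<close> only increases the power.
\<close>
lemma thickening_volume_le:
  fixes U :: "(real ^ 'n::finite) set" and s :: real
  assumes U: "bounded U" "diameter U \<le> 1" and s: "0 \<le> s" "s < card J"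
  shows "\<exists>V\<in>sets lborel. {y \<in> box 0 1. \<exists>x\<in>U. \<forall>j\<in>J. x $ j = y $ j} \<subseteq> V
           \<and> emeasure lborel V \<le> 2 ^ card J * diam_pow s U"
proof (cases "U = {}")
  case True
  then show ?thesis by (intro bexI[of _ "{}"]) auto
next
  case False
  then obtain u where u: "u \<in> U" by blast
  define D where "D = diameter U"
  have D: "0 \<le> D" "D \<le> 1" using U diameter_ge_0 by (auto simp: D_def)
  define a b :: "real ^ 'n"
    where "a = (\<chi> j. if j \<in> J then u $ j - D else 0)"
      and "b = (\<chi> j. if j \<in> J then u $ j + D else 1)"
  have le: "a $ j \<le> b $ j" for j using D by (simp add: a_def b_def)
  have near: "\<bar>x $ j - u $ j\<bar> \<le> D" if "x \<in> U" for x j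
  proof -
    have "\<bar>(x - u) $ j\<bar> \<le> norm (x - u)" by (rule component_le_norm_cart)
    also have "\<dots> \<le> D"
      using diameter_bounded_bound[OF U(1) that u] by (simp add: D_def dist_norm)
    finally show ?thesis by simp
  qed
  have "{y \<in> box 0 1. \<exists>x\<in>U. \<forall>j\<in>J. x $ j = y $ j} \<subseteq> cbox a b"
  proof clarify
    fix y x assume y: "y \<in> box 0 1" and x: "x \<in> U" "\<forall>j\<in>J. x $ j = y $ j"
    show "y \<in> cbox a b"
      unfolding mem_box_cart
    proof
      fix j
      show "a $ j \<le> y $ j \<and> y $ j \<le> b $ j"
        using near[OF x(1), of j] x(2) y
        by (cases "j \<in> J") (auto simp: a_def b_def mem_box_cart abs_le_iff less_imp_le)
    qed
  qed
  moreover have "emeasure lborel (cbox a b) \<le> 2 ^ card J * diam_pow s U"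
  proof -
    have "cbox a b \<noteq> {}" using le by (auto simp: interval_ne_empty_cart)
    then have "measure lborel (cbox a b) = (\<Prod>j\<in>UNIV. b $ j - a $ j)"
      by (rule content_cbox_cart)
    also have "\<dots> = (\<Prod>j\<in>UNIV. if j \<in> J then 2 * D else 1)"
      by (intro prod.cong) (auto simp: a_def b_def)
    also have "\<dots> = (2 * D) ^ card J"
      by (simp add: prod.If_cases)
    finally have vol: "emeasure lborel (cbox a b) = ennreal ((2 * D) ^ card J)"
      using emeasure_lborel_cbox_finite[of a b] by (simp add: emeasure_eq_ennreal_measure)
    have "ennreal (D ^ card J) \<le> diam_pow s U"
    proof (cases "s = 0")
      case True
      then show ?thesis
        using False D by (auto simp: diam_pow_def power_le_one simp flip: ennreal_1 intro!: ennreal_leI)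
    next
      case s0: False
      have "D ^ card J \<le> D powr s"
      proof (cases "D = 0")
        case True
        have "J \<noteq> {}" using s by auto
        with True show ?thesis by (simp add: power_0_left)
      next
        case False
        then have "D ^ card J = D powr card J" using D by (simp add: powr_realpow)
        also have "\<dots> \<le> D powr s" using D False s by (intro powr_mono') auto
        finally show ?thesis .
      qed
      then show ?thesis using s0 False by (simp add: diam_pow_def D_def ennreal_leI)
    qed
    then have "ennreal (2 ^ card J) * ennreal (D ^ card J) \<le> ennreal (2 ^ card J) * diam_pow s U"
      by (rule mult_left_mono) simp
    moreover have "ennreal (2 ^ card J) = 2 ^ card J"
      by (simp flip: ennreal_power)
    ultimately show ?thesis using D vol by (simp add: power_mult_distrib ennreal_mult)
  qed
  ultimately show ?thesis by (intro bexI[of _ "cbox a b"]) auto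
qed

text \<open>
  A mass distribution argument: the thickened pieces of any cover of \<open>A\<close> cover the unit cube, so
  their volumes add up to at least \<open>1\<close>, and no cover can have small \<open>s\<close>-dimensional mass when
  \<open>s < card J\<close>.
\<close>
lemma card_le_hausdorff_dim:
  fixes A :: "(real ^ 'n::finite) set"
  assumes onto: "\<And>y. y \<in> box 0 1 \<Longrightarrow> \<exists>x\<in>A. \<forall>j\<in>J. x $ j = y $ j"
  shows "ennreal (card J) \<le> hausdorff_dim A"
  unfolding hausdorff_dim_def
proof (rule INF_greatest, rule ccontr)
  fix s assume "s \<in> {s. 0 \<le> s \<and> hausdorff_measure s A = 0}"
    and "\<not> ennreal (card J) \<le> ennreal s"
  then have s: "0 \<le> s" "s < card J" and H: "hausdorff_measure s A = 0"
    by (auto simp: ennreal_le_iff)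
  have "hausdorff_premeasure s 1 A \<le> hausdorff_measure s A"
    unfolding hausdorff_measure_def by (rule SUP_upper) simp
  then have "hausdorff_premeasure s 1 A = 0" using H by simp
  moreover have "inverse (2 ^ card J) \<le> hausdorff_premeasure s 1 A"
    unfolding hausdorff_premeasure_def
  proof (rule INF_greatest)
    fix U :: "nat \<Rightarrow> (real ^ 'n) set"
    assume "U \<in> {U. A \<subseteq> (\<Union>i. U i) \<and> (\<forall>i. bounded (U i) \<and> diameter (U i) \<le> 1)}"
    then have U: "A \<subseteq> (\<Union>i. U i)" "\<And>i. bounded (U i)" "\<And>i. diameter (U i) \<le> 1" by auto
    have "\<forall>i. \<exists>V\<in>sets lborel. {y \<in> box 0 1. \<exists>x\<in>U i. \<forall>j\<in>J. x $ j = y $ j} \<subseteq> V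
           \<and> emeasure lborel V \<le> 2 ^ card J * diam_pow s (U i)"
      using thickening_volume_le[OF U(2,3) s] by blast
    then obtain V where "\<forall>i. V i \<in> sets lborel
        \<and> {y \<in> box 0 1. \<exists>x\<in>U i. \<forall>j\<in>J. x $ j = y $ j} \<subseteq> V i
        \<and> emeasure lborel (V i) \<le> 2 ^ card J * diam_pow s (U i)"
      unfolding Bex_def choice_iff by blast
    then have V: "\<And>i. V i \<in> sets lborel"
      "\<And>i. {y \<in> box 0 1. \<exists>x\<in>U i. \<forall>j\<in>J. x $ j = y $ j} \<subseteq> V i"
      "\<And>i. emeasure lborel (V i) \<le> 2 ^ card J * diam_pow s (U i)"
      by simp_all
    have "(1 :: real ^ 'n) \<bullet> e = 1" if "e \<in> Basis" for e
      using that by (auto simp: Basis_vec_def inner_axis)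
    then have unit_volume: "emeasure lborel (box 0 1 :: (real ^ 'n) set) = 1"
      by (simp add: emeasure_lborel_box_eq)
    have "box 0 1 \<subseteq> (\<Union>i. V i)"
    proof
      fix y :: "real ^ 'n" assume y: "y \<in> box 0 1"
      then obtain x where "x \<in> A" "\<forall>j\<in>J. x $ j = y $ j" using onto by blast
      moreover from this obtain i where "x \<in> U i" using U(1) by blast
      ultimately show "y \<in> (\<Union>i. V i)" using V(2)[of i] y by blast
    qed
    then have "emeasure lborel (box 0 1 :: (real ^ 'n) set) \<le> emeasure lborel (\<Union>i. V i)"
      using V(1) by (intro emeasure_mono) auto
    also have "\<dots> \<le> (\<Sum>i. emeasure lborel (V i))"
      using V(1) by (intro emeasure_subadditive_countably) auto
    also have "\<dots> \<le> (\<Sum>i. 2 ^ card J * diam_pow s (U i))"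
      by (intro suminf_le V(3)) auto
    also have "\<dots> = 2 ^ card J * (\<Sum>i. diam_pow s (U i))" by simp
    finally have "1 \<le> 2 ^ card J * (\<Sum>i. diam_pow s (U i))"
      using unit_volume by simp
    then have "inverse (2 ^ card J) * 1
        \<le> inverse (2 ^ card J) * (2 ^ card J * (\<Sum>i. diam_pow s (U i)))"
      by (rule mult_left_mono) simp
    also have "\<dots> = (\<Sum>i. diam_pow s (U i))"
    proof -
      have "inverse (2 ^ card J) * 2 ^ card J = (1 :: ennreal)"
        using ennreal_divide_self[of "2 ^ card J"]
        by (simp add: divide_ennreal_def mult.commute power_less_top_ennreal)
      then show ?thesis by (simp add: mult.assoc[symmetric])
    qed
    finally show "inverse (2 ^ card J) \<le> (\<Sum>i. diam_pow s (U i))" by simp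
  qed
  ultimately show False by (simp add: power_eq_top_ennreal)
qed

lemma hausdorff_dim_empty: "hausdorff_dim ({} :: 'a::metric_space set) = 0"
proof -
  have "hausdorff_premeasure 0 \<delta> ({} :: 'a set) = 0" if "0 < \<delta>" for \<delta>
  proof -
    have "hausdorff_premeasure 0 \<delta> ({} :: 'a set) \<le> (\<Sum>i::nat. diam_pow 0 ({} :: 'a set))"
      unfolding hausdorff_premeasure_def by (rule INF_lower2[of "\<lambda>_. {}"]) (use that in auto)
    then show ?thesis by (simp add: diam_pow_def)
  qed
  then have "hausdorff_measure 0 ({} :: 'a set) = 0"
    by (simp add: hausdorff_measure_def)
  then have "hausdorff_dim ({} :: 'a set) \<le> ennreal 0"
    unfolding hausdorff_dim_def by (intro INF_lower) simp
  then show ?thesis by simp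
qed

section \<open>Illumination of the cube\<close>

text \<open>
  Some finite set of directions is admissible at all, so that the least cardinality is attained:
  the normalised sign vectors illuminate every point, since moving each coordinate by
  \<open>1/4\<close>, upwards if it is below \<open>1/2\<close> and downwards otherwise, leads into the interior.
\<close>
lemma sign_directions_illuminate_cube:
  "\<exists>L :: (real ^ 'n::finite) set. finite L \<and> (\<forall>l\<in>L. norm l = 1) \<and> unilluminated (cbox 0 1) L = {}"
proof -
  define w :: "('n \<Rightarrow> bool) \<Rightarrow> real ^ 'n" where "w v = (\<chi> i. if v i then 1 else -1)" for v
  have w: "norm (w v) > 0" for v
  proof -
    have "w v $ i \<noteq> 0" for i by (simp add: w_def)
    then have "w v \<noteq> 0" by (metis zero_index)
    then show ?thesis by simp
  qed
  define L where "L = range (\<lambda>v. w v /\<^sub>R norm (w v))"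
  have "\<exists>l\<in>L. illuminates (cbox 0 1) l x" if "x \<in> frontier (cbox 0 1)" for x
  proof -
    have x: "0 \<le> x $ i" "x $ i \<le> 1" for i
      using that by (auto simp: frontier_cbox mem_box_cart)
    define v where "v i \<longleftrightarrow> x $ i < 1/2" for i
    have "x + (norm (w v) / 4) *\<^sub>R (w v /\<^sub>R norm (w v)) = x + (1/4) *\<^sub>R w v"
      using w[of v] by simp
    moreover have "x + (1/4) *\<^sub>R w v \<in> box 0 1"
      unfolding mem_box_cart
    proof
      fix i
      show "0 $ i < (x + (1/4) *\<^sub>R w v) $ i \<and> (x + (1/4) *\<^sub>R w v) $ i < 1 $ i"
        using x[of i] by (auto simp: w_def v_def)
    qed
    ultimately have "illuminates (cbox 0 1) (w v /\<^sub>R norm (w v)) x"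
      unfolding illuminates_def interior_cbox disjoint_iff
      using w[of v] by (auto intro!: exI[of _ "x + (1/4) *\<^sub>R w v"] exI[of _ "norm (w v) / 4"])
    then show ?thesis by (auto simp: L_def)
  qed
  then have "unilluminated (cbox 0 1) L = {}" by (auto simp: unilluminated_def)
  moreover have "finite L" "\<forall>l\<in>L. norm l = 1" using w by (auto simp: L_def)
  ultimately show ?thesis by blast
qed

text \<open>
  If the sign pattern \<open>v\<close> is missed, then so is the whole relative interior of the face on which
  the coordinates in \<open>T\<close> are fixed at \<open>1\<close> where \<open>v\<close> is negative and at \<open>0\<close> elsewhere.
\<close>
lemma sign_patterns_cover:
  fixes L :: "(real ^ 'n::finite) set"
  assumes T: "T \<noteq> {}" and dim: "hausdorff_dim (unilluminated (cbox 0 1) L) < ennreal (card (- T))"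
  shows "\<exists>l\<in>L. \<forall>i\<in>T. (l $ i < 0) = v i"
proof (rule ccontr)
  assume miss: "\<not> ?thesis"
  have "\<exists>x\<in>unilluminated (cbox 0 1) L. \<forall>j\<in>- T. x $ j = y $ j" if y: "y \<in> box 0 1" for y
  proof -
    define x :: "real ^ 'n" where "x = (\<chi> i. if i \<in> T then if v i then 1 else 0 else y $ i)"
    have "x \<in> cbox 0 1" using y by (auto simp: mem_box_cart x_def less_imp_le)
    moreover have "x \<notin> box 0 1" using T by (auto simp: mem_box_cart x_def)
    moreover have "\<not> illuminates (cbox 0 1) l x" if "l \<in> L" for l
    proof
      assume "illuminates (cbox 0 1) l x"
      then obtain r where r: "r > 0" "x + r *\<^sub>R l \<in> box 0 1"
        by (auto simp: illuminates_def interior_cbox)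
      have "(l $ i < 0) = v i" if "i \<in> T" for i
      proof -
        have "0 < x $ i + r * l $ i" "x $ i + r * l $ i < 1" using r(2) by (auto simp: mem_box_cart)
        then show ?thesis using r(1) that
          by (cases "v i") (auto simp: x_def mult_less_0_iff zero_less_mult_iff)
      qed
      then show False using miss \<open>l \<in> L\<close> by blast
    qed
    ultimately have "x \<in> unilluminated (cbox 0 1) L"
      by (auto simp: unilluminated_def frontier_cbox)
    then show ?thesis by (rule bexI[rotated]) (simp add: x_def)
  qed
  then have "ennreal (card (- T)) \<le> hausdorff_dim (unilluminated (cbox 0 1) L)"
    by (rule card_le_hausdorff_dim)
  then show False using dim by simp
qed

theorem theorem5:
  fixes \<alpha> :: nat
  assumes "8 \<le> CARD('n::finite)"
    and "2 \<le> \<alpha>" and "\<alpha> \<le> CARD('n) - 2"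
  shows "illum_number (real \<alpha>) {x :: real ^ 'n. \<forall>i. 0 \<le> x $ i \<and> x $ i \<le> 1}
           > 2 ^ (CARD('n) - \<alpha>)"
proof -
  let ?B = "cbox 0 1 :: (real ^ 'n) set"
  let ?P = "\<lambda>n. \<exists>L. finite L \<and> card L = n \<and> (\<forall>l\<in>L. norm l = 1) \<and>
              hausdorff_dim (unilluminated ?B L) < ennreal (real \<alpha>)"
  have cube: "{x :: real ^ 'n. \<forall>i. 0 \<le> x $ i \<and> x $ i \<le> 1} = ?B"
    by (auto simp: mem_box_cart)
  obtain L0 :: "(real ^ 'n) set" where "finite L0" "\<forall>l\<in>L0. norm l = 1" "unilluminated ?B L0 = {}"
    using sign_directions_illuminate_cube by blast
  then have "?P (card L0)" using assms(2) by (auto simp: hausdorff_dim_empty)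
  then have "?P (LEAST n. ?P n)" by (rule LeastI)
  then obtain L where L: "finite L" "card L = illum_number \<alpha> ?B"
    "hausdorff_dim (unilluminated ?B L) < ennreal \<alpha>"
    unfolding illum_number_def by blast
  let ?C = "(\<lambda>l i. l $ i < 0) ` L"
  have "2 ^ (CARD('n) - \<alpha>) < card ?C"
  proof (rule covering_array_card_gt)
    fix T :: "'n set" and v :: "'n \<Rightarrow> bool"
    assume T: "card T = CARD('n) - \<alpha>"
    have "card (- T) = \<alpha>" using T assms by (simp add: Compl_eq_Diff_UNIV card_Diff_subset)
    moreover have "T \<noteq> {}" using T assms by auto
    ultimately have "\<exists>l\<in>L. \<forall>i\<in>T. (l $ i < 0) = v i"
      using sign_patterns_cover[of T L v] L(3) by simp
    then show "\<exists>c\<in>?C. \<forall>i\<in>T. c i = v i" by simp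
  qed (use assms in auto)
  also have "\<dots> \<le> card L" using L(1) by (rule card_image_le)
  finally show ?thesis using L(2) cube by simp
qed

end
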